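(* Consider a quadrilateral mesh with cells $\omega^1,\dots,\omega^I$ and vertex set $\mathcal X$, with boundary conditions omitted, i.e. every edge of every cell is shared by exactly two cells. Let the nodal velocities $\tilde{\mathbf v}$ and half-edge pressures $\widetilde P$ satisfy the jump condition and the balance condition described in the context, and let the cell averages evolve by the semi-discrete momentum and energy equations described in the context. Then total momentum and total energy are conserved: $$\Big(\sum_{i=1}^I m^i\bar{\mathbf v}^i\Big)_t=-\frac12\sum_{i=1}^I\sum_{r=1}^4 L^i_{r,r+1}\big(\widetilde P^i_{r,r+\frac12}+\widetilde P^i_{r+\frac12,r+1}\big)\mathbf n^i_{r,r+1}=-\frac12\sum_{\boldsymbol x\in\mathcal X}\sum_{e\in\mathcal E(\boldsymbol x)}L_e\big(\widetilde P_{e+}-\widetilde P_{e-}\big)\mathbf n_e=\boldsymbol 0,$$ $$\Big(\sum_{i=1}^I m^i\bar E^i\Big)_t=-\frac12\sum_{i=1}^I\sum_{r=1}^4 L^i_{r,r+1}\big(\widetilde P^i_{r,r+\frac12}\tilde{\mathbf v}^i_r+\widetilde P^i_{r+\frac12,r+1}\tilde{\mathbf v}^i_{r+1}\big)\cdot\mathbf n^i_{r,r+1}=-\frac12\sum_{\boldsymbol x\in\mathcal X}\tilde{\mathbf v}(\boldsymbol x)\cdot\Big[\sum_{e\in\mathcal E(\boldsymbol x)}L_e\big(\widetilde P_{e+}-\widetilde P_{e-}\big)\mathbf n_e\Big]=0.$$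
   Context: Mesh notation. Each cell $\omega^i$ is a quadrilateral with vertices $\boldsymbol x^i_1,\dots,\boldsymbol x^i_4$ in counterclockwise order (indices $r$ taken cyclically mod 4). $L^i_{r,r+1}$ and $\mathbf n^i_{r,r+1}$ are the length and the unit outward normal of the straight edge $\overline{\boldsymbol x^i_r\boldsymbol x^i_{r+1}}$, and $\boldsymbol x^i_{r+\frac12}=\frac12\boldsymbol x^i_r+\frac12\boldsymbol x^i_{r+1}$. "Boundary conditions omitted" means every edge is shared by exactly two cells (for instance a periodically identified mesh), so no boundary terms occur. Input data. In each cell $\omega^i$, velocities $\mathbf v^i_r,\mathbf v^i_{r+\frac12}\in\mathbb R^2$, pressures $P^i_r,P^i_{r+\frac12}$ and acoustic impedances $\alpha^i_r,\alpha^i_{r+\frac12}>0$ are given at the vertices $\boldsymbol x^i_r$ and edge midpoints $\boldsymbol x^i_{r+\frac12}$ (these values may differ from cell to cell at the same point). Nodal velocity. Each vertex $\boldsymbol x\in\mathcal X$ carries a single velocity $\tilde{\mathbf v}(\boldsymbol x)\in\mathbb R^2$, and $\tilde{\mathbf v}^i_r=\tilde{\mathbf v}(\boldsymbol x^i_r)$. Half edges. For a vertex $\boldsymbol x$, $\mathcal E(\boldsymbol x)$ is the set of all half edges having $\boldsymbol x$ as an endpoint (a half edge joins a vertex to the midpoint of an edge at that vertex). Each $e\in\mathcal E(\boldsymbol x)$ can be written uniquely as $e=\overline{\boldsymbol x^i_r\boldsymbol x^i_{r+\frac12}}=\overline{\boldsymbol x^j_{k-\frac12}\boldsymbol x^j_k}\subset\omega^i\cap\omega^j$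 with $\boldsymbol x=\boldsymbol x^i_r=\boldsymbol x^j_k$. $L_e$ is its length, $\mathbf n_e=\mathbf n^i_{r,r+1}=-\mathbf n^j_{k-1,k}$ is the unit normal outward to $\omega^i$, and $\widetilde P_{e+}=\widetilde P^i_{r,r+\frac12}$, $\widetilde P_{e-}=\widetilde P^j_{k-\frac12,k}$. Jump condition. For every such $e$, $$\widetilde P^i_{r,r+\frac12}=\Big(\tfrac13P^i_r+\tfrac23P^i_{r+\frac12}+\alpha^i_{r+\frac12}w^i_{r+\frac12}\Big)-\Big(\tfrac13\alpha^i_r+\tfrac23\alpha^i_{r+\frac12}\Big)\big(\tilde{\mathbf v}^i_r-\mathbf v^i_r\big)\cdot\mathbf n^i_{r,r+1},$$ $$\widetilde P^j_{k-\frac12,k}=\Big(\tfrac13P^j_k+\tfrac23P^j_{k-\frac12}+\alpha^j_{k-\frac12}w^j_{k-\frac12}\Big)-\Big(\tfrac13\alpha^j_k+\tfrac23\alpha^j_{k-\frac12}\Big)\big(\tilde{\mathbf v}^i_r-\mathbf v^j_k\big)\cdot\mathbf n^j_{k-1,k},$$ where $w^i_{r+\frac12}=\frac23\big(\mathbf v^i_{r+\frac12}-\frac12\mathbf v^i_r-\frac12\mathbf v^i_{r+1}\big)\cdot\mathbf n^i_{r,r+1}$ and $w^j_{k-\frac12}=\frac23\big(\mathbf v^j_{k-\frac12}-\frac12\mathbf v^j_k-\frac12\mathbf v^j_{k-1}\big)\cdot\mathbf n^j_{k-1,k}$. Balance condition. For every vertex $\boldsymbol x$, $\sum_{e\in\mathcal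 E(\boldsymbol x)}L_e(\widetilde P_{e+}-\widetilde P_{e-})\mathbf n_e=\boldsymbol 0$. Evolution of cell averages. $m^i$ is the (time-constant) mass of $\omega^i$; $\bar{\mathbf v}^i$ and $\bar E^i$ are the average velocity and average specific total energy of $\omega^i$; the subscript $t$ denotes time derivative: $$m^i(\bar{\mathbf v}^i)_t=-\frac12\sum_{r=1}^4L^i_{r,r+1}\big(\widetilde P^i_{r,r+\frac12}+\widetilde P^i_{r+\frac12,r+1}\big)\mathbf n^i_{r,r+1},$$ $$m^i(\bar E^i)_t=-\frac12\sum_{r=1}^4L^i_{r,r+1}\big(\widetilde P^i_{r,r+\frac12}\tilde{\mathbf v}^i_r+\widetilde P^i_{r+\frac12,r+1}\tilde{\mathbf v}^i_{r+1}\big)\cdot\mathbf n^i_{r,r+1}.$$ *)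

theory Defs
  imports "HOL-Analysis.Analysis"
begin

section \<open>Quadrilateral meshes with identified edges\<close>

text \<open>
  The local indices \<open>r\<close> live in the cyclic ring \<open>4\<close> (integers modulo 4), so that the corners
  \<open>1, 2, 3, 4 = 0\<close> and all shifts \<open>r + 1\<close>, \<open>r - 1\<close> are automatically cyclic.

  A finite mesh in which every edge is shared by exactly two cells cannot lie in the plane; it only
  arises after an identification, e.g.\ a periodic one. Every cell \<open>i\<close> therefore has its
  own planar coordinates, and \<open>embed M i\<close> sends the coordinates used by cell \<open>i\<close> to points of the
  identified domain, of type \<open>'p\<close>. For a periodic mesh, all \<open>embed M i\<close> are the quotient map
  from the plane to the torus. Vertices, edges and half edges are (sets of) points of
  the identified domain.
\<close>

record 'p mesh =
  ncells :: nat
  corner :: "nat \<Rightarrow> 4 \<Rightarrow> real^2"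
  embed  :: "nat \<Rightarrow> real^2 \<Rightarrow> 'p"

definition cells :: "'p mesh \<Rightarrow> nat set" where
  "cells M = {1..ncells M}"

definition edge_mid :: "'p mesh \<Rightarrow> nat \<Rightarrow> 4 \<Rightarrow> real^2" where
  "edge_mid M i r = midpoint (corner M i r) (corner M i (r + 1))"

definition edge_length :: "'p mesh \<Rightarrow> nat \<Rightarrow> 4 \<Rightarrow> real" where
  "edge_length M i r = dist (corner M i r) (corner M i (r + 1))"

text \<open>
  The edge vector divided by its length and rotated clockwise by a right angle; this is the
  outward unit normal because the corners are numbered counterclockwise.
\<close>

definition normal_vec :: "'p mesh \<Rightarrow> nat \<Rightarrow> 4 \<Rightarrow> real^2" where
  "normal_vec M i r =
     (let d = corner M i (r + 1) - corner M i r
      in (1 / edge_length M i r) *\<^sub>R vector [d $ 2, - d $ 1])"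

definition node :: "'p mesh \<Rightarrow> nat \<Rightarrow> 4 \<Rightarrow> 'p" where
  "node M i r = embed M i (corner M i r)"

definition side :: "'p mesh \<Rightarrow> nat \<Rightarrow> 4 \<Rightarrow> (real^2) set" where
  "side M i r = closed_segment (corner M i r) (corner M i (r + 1))"

definition edge :: "'p mesh \<Rightarrow> nat \<Rightarrow> 4 \<Rightarrow> 'p set" where
  "edge M i r = embed M i ` side M i r"

definition half_fst :: "'p mesh \<Rightarrow> nat \<Rightarrow> 4 \<Rightarrow> 'p set" where
  "half_fst M i r = embed M i ` closed_segment (corner M i r) (edge_mid M i r)"

definition half_snd :: "'p mesh \<Rightarrow> nat \<Rightarrow> 4 \<Rightarrow> 'p set" where
  "half_snd M i r = embed M i ` closed_segment (edge_mid M i r) (corner M i (r + 1))"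

definition vertices :: "'p mesh \<Rightarrow> 'p set" where
  "vertices M = {node M i r | i r. i \<in> cells M}"

definition half_edges :: "'p mesh \<Rightarrow> 'p \<Rightarrow> 'p set set" where
  "half_edges M x =
     {half_fst M i r | i r. i \<in> cells M \<and> node M i r = x} \<union>
     {half_snd M i r | i r. i \<in> cells M \<and> node M i (r + 1) = x}"

text \<open>
  Simple quadrilateral (not necessarily convex) with positive signed area, i.e.\ with
  corners in counterclockwise order (shoelace formula). The first condition also forces the edges
  to have positive length.
\<close>

definition ccw_quadrilateral :: "(4 \<Rightarrow> real^2) \<Rightarrow> bool" where
  "ccw_quadrilateral c \<longleftrightarrow>
     (\<forall>r. closed_segment (c r) (c (r + 1)) \<inter> closed_segment (c (r + 2)) (c (r + 3)) = {}) \<and>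
     (\<forall>r. closed_segment (c r) (c (r + 1)) \<inter> closed_segment (c (r + 1)) (c (r + 2)) = {c (r + 1)}) \<and>
     0 < (\<Sum>r\<in>UNIV. c r $ 1 * c (r + 1) $ 2 - c (r + 1) $ 1 * c r $ 2)"

text \<open>
  Besides the shape of the cells, the conditions say: an edge has no self-contact at interior
  points; the mesh is conforming (different edges touch at most in end points); the four edges of
  a cell are different; every edge is shared by exactly two cells; and two cells sharing an edge
  see it up to a translation, traversed in opposite directions since both are numbered
  counterclockwise. Corners of one cell may be identified with each other.
\<close>

definition closed_quad_mesh :: "'p mesh \<Rightarrow> bool" where
  "closed_quad_mesh M \<longleftrightarrow>
     (\<forall>i\<in>cells M. ccw_quadrilateral (corner M i)) \<and>
     (\<forall>i\<in>cells M. \<forall>r. \<forall>p\<in>open_segment (corner M i r) (corner M i (r + 1)). \<forall>q\<in>side M i r.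
        embed M i p = embed M i q \<longrightarrow> p = q) \<and>
     (\<forall>i\<in>cells M. \<forall>j\<in>cells M. \<forall>r s.
        \<forall>p\<in>open_segment (corner M i r) (corner M i (r + 1)). \<forall>q\<in>side M j s.
        embed M i p = embed M j q \<longrightarrow> edge M i r = edge M j s) \<and>
     (\<forall>i\<in>cells M. inj (edge M i)) \<and>
     (\<forall>i\<in>cells M. \<forall>r. card {j\<in>cells M. \<exists>s. edge M j s = edge M i r} = 2) \<and>
     (\<forall>i\<in>cells M. \<forall>j\<in>cells M. \<forall>r s. i \<noteq> j \<and> edge M i r = edge M j s \<longrightarrow>
        corner M i (r + 1) - corner M i r = corner M j s - corner M j (s + 1) \<and>
        (\<forall>p\<in>side M i r. embed M i p = embed M j (p + (corner M j (s + 1) - corner M i r))))"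

text \<open>
  \<open>e\<close> is the first half of edge \<open>r\<close> of cell \<open>i\<close> and the second half of edge \<open>k - 1\<close> of cell \<open>j\<close>,
  and \<open>x\<close> is corner \<open>r\<close> of \<open>i\<close> and corner \<open>k\<close> of \<open>j\<close>. In a closed mesh, every
  half edge at \<open>x\<close> has exactly one such representation (lemma \<open>half_edge_repr_ex1\<close> below), hence the
  definite description in \<open>half_edge_sides\<close>.
\<close>

definition half_edge_repr ::
    "'p mesh \<Rightarrow> 'p \<Rightarrow> 'p set \<Rightarrow> nat \<Rightarrow> 4 \<Rightarrow> nat \<Rightarrow> 4 \<Rightarrow> bool" where
  "half_edge_repr M x e i r j k \<longleftrightarrow>
     i \<in> cells M \<and> j \<in> cells M \<and> e = half_fst M i r \<and> e = half_snd M j (k - 1) \<and>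
     x = node M i r \<and> x = node M j k"

definition half_edge_sides :: "'p mesh \<Rightarrow> 'p \<Rightarrow> 'p set \<Rightarrow> nat \<times> 4 \<times> nat \<times> 4" where
  "half_edge_sides M x e = (THE (i, r, j, k). half_edge_repr M x e i r j k)"

text \<open>The length of the half edge itself, i.e.\ half of the length of the edge.\<close>

definition half_edge_length :: "'p mesh \<Rightarrow> 'p \<Rightarrow> 'p set \<Rightarrow> real" where
  "half_edge_length M x e =
     (case half_edge_sides M x e of (i, r, j, k) \<Rightarrow> dist (corner M i r) (edge_mid M i r))"

definition half_edge_normal :: "'p mesh \<Rightarrow> 'p \<Rightarrow> 'p set \<Rightarrow> real^2" where
  "half_edge_normal M x e =
     (case half_edge_sides M x e of (i, r, j, k) \<Rightarrow> normal_vec M i r)"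

section \<open>Nodal solver\<close>

text \<open>
  Input data of a cell at its corners (\<open>vel i r\<close>, at \<open>r\<close>) and edge midpoints
  (\<open>vel_mid i r\<close>, at \<open>r + 1/2\<close>).
\<close>

record input_data =
  vel     :: "nat \<Rightarrow> 4 \<Rightarrow> real^2"
  vel_mid :: "nat \<Rightarrow> 4 \<Rightarrow> real^2"
  prs     :: "nat \<Rightarrow> 4 \<Rightarrow> real"
  prs_mid :: "nat \<Rightarrow> 4 \<Rightarrow> real"
  imp     :: "nat \<Rightarrow> 4 \<Rightarrow> real"
  imp_mid :: "nat \<Rightarrow> 4 \<Rightarrow> real"

text \<open>
  \<open>hp_fst hp i r\<close> is the pressure of cell \<open>i\<close> on the half edge from \<open>r\<close> to \<open>r + 1/2\<close>, and
  \<open>hp_snd hp i r\<close> the one on the half edge from \<open>r + 1/2\<close> to \<open>r + 1\<close>.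
\<close>

record half_pressures =
  hp_fst :: "nat \<Rightarrow> 4 \<Rightarrow> real"
  hp_snd :: "nat \<Rightarrow> 4 \<Rightarrow> real"

definition pressure_plus :: "'p mesh \<Rightarrow> half_pressures \<Rightarrow> 'p \<Rightarrow> 'p set \<Rightarrow> real" where
  "pressure_plus M hp x e = (case half_edge_sides M x e of (i, r, j, k) \<Rightarrow> hp_fst hp i r)"

definition pressure_minus :: "'p mesh \<Rightarrow> half_pressures \<Rightarrow> 'p \<Rightarrow> 'p set \<Rightarrow> real" where
  "pressure_minus M hp x e = (case half_edge_sides M x e of (i, r, j, k) \<Rightarrow> hp_snd hp j (k - 1))"

definition w_mid :: "'p mesh \<Rightarrow> input_data \<Rightarrow> nat \<Rightarrow> 4 \<Rightarrow> real" where
  "w_mid M D i r =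
     2/3 * ((vel_mid D i r - (1/2) *\<^sub>R vel D i r - (1/2) *\<^sub>R vel D i (r + 1)) \<bullet> normal_vec M i r)"

definition jump_condition ::
    "'p mesh \<Rightarrow> input_data \<Rightarrow> ('p \<Rightarrow> real^2) \<Rightarrow> half_pressures \<Rightarrow> bool" where
  "jump_condition M D vt hp \<longleftrightarrow>
     (\<forall>x\<in>vertices M. \<forall>e\<in>half_edges M x. \<forall>i r j k. half_edge_repr M x e i r j k \<longrightarrow>
        hp_fst hp i r =
          (1/3 * prs D i r + 2/3 * prs_mid D i r + imp_mid D i r * w_mid M D i r)
          - (1/3 * imp D i r + 2/3 * imp_mid D i r) * ((vt x - vel D i r) \<bullet> normal_vec M i r) \<and>
        hp_snd hp j (k - 1) =
          (1/3 * prs D j k + 2/3 * prs_mid D j (k - 1) + imp_mid D j (k - 1) * w_mid M D j (k - 1))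
          - (1/3 * imp D j k + 2/3 * imp_mid D j (k - 1))
            * ((vt x - vel D j k) \<bullet> normal_vec M j (k - 1)))"

definition node_force :: "'p mesh \<Rightarrow> half_pressures \<Rightarrow> 'p \<Rightarrow> real^2" where
  "node_force M hp x =
     (\<Sum>e\<in>half_edges M x.
        (half_edge_length M x e * (pressure_plus M hp x e - pressure_minus M hp x e))
          *\<^sub>R half_edge_normal M x e)"

definition balance_condition :: "'p mesh \<Rightarrow> half_pressures \<Rightarrow> bool" where
  "balance_condition M hp \<longleftrightarrow> (\<forall>x\<in>vertices M. node_force M hp x = 0)"

definition momentum_flux :: "'p mesh \<Rightarrow> half_pressures \<Rightarrow> nat \<Rightarrow> real^2" where
  "momentum_flux M hp i =
     (\<Sum>r\<in>UNIV. (edge_length M i r * (hp_fst hp i r + hp_snd hp i r)) *\<^sub>R normal_vec M i r)"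

definition energy_flux :: "'p mesh \<Rightarrow> ('p \<Rightarrow> real^2) \<Rightarrow> half_pressures \<Rightarrow> nat \<Rightarrow> real" where
  "energy_flux M vt hp i =
     (\<Sum>r\<in>UNIV. edge_length M i r *
        ((hp_fst hp i r *\<^sub>R vt (node M i r) + hp_snd hp i r *\<^sub>R vt (node M i (r + 1)))
          \<bullet> normal_vec M i r))"

section \<open>Well-definedness of the half-edge notation\<close>

lemma closed_quad_meshD:
  assumes "closed_quad_mesh M" "i \<in> cells M"
  shows "ccw_quadrilateral (corner M i)"
    and "\<And>r p q. p \<in> open_segment (corner M i r) (corner M i (r + 1)) \<Longrightarrow> q \<in> side M i r \<Longrightarrow>
          embed M i p = embed M i q \<Longrightarrow> p = q"
    and "\<And>j r s p q. j \<in> cells M \<Longrightarrow> p \<in> open_segment (corner M i r) (corner M i (r + 1)) \<Longrightarrow>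
          q \<in> side M j s \<Longrightarrow> embed M i p = embed M j q \<Longrightarrow> edge M i r = edge M j s"
    and "\<And>r s. edge M i r = edge M i s \<Longrightarrow> r = s"
    and "\<And>r. card {j\<in>cells M. \<exists>s. edge M j s = edge M i r} = 2"
    and "\<And>j r s. j \<in> cells M \<Longrightarrow> i \<noteq> j \<Longrightarrow> edge M i r = edge M j s \<Longrightarrow>
          corner M i (r + 1) - corner M i r = corner M j s - corner M j (s + 1)"
    and "\<And>j r s p. j \<in> cells M \<Longrightarrow> i \<noteq> j \<Longrightarrow> edge M i r = edge M j s \<Longrightarrow> p \<in> side M i r \<Longrightarrow>
          embed M i p = embed M j (p + (corner M j (s + 1) - corner M i r))"
proof -
  note c = assms(1)[unfolded closed_quad_mesh_def]
  note c1 = c[THEN conjunct1] and d1 = c[THEN conjunct2]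
  note c2 = d1[THEN conjunct1] and d2 = d1[THEN conjunct2]
  note c3 = d2[THEN conjunct1] and d3 = d2[THEN conjunct2]
  note c4 = d3[THEN conjunct1] and d4 = d3[THEN conjunct2]
  note c5 = d4[THEN conjunct1] and c6 = d4[THEN conjunct2]
  show "ccw_quadrilateral (corner M i)"
    by (rule c1[rule_format, OF assms(2)])
  show "p = q" if "p \<in> open_segment (corner M i r) (corner M i (r + 1))" "q \<in> side M i r"
      "embed M i p = embed M i q" for r p q
    by (rule c2[rule_format, OF assms(2) that])
  show "edge M i r = edge M j s" if "j \<in> cells M"
      "p \<in> open_segment (corner M i r) (corner M i (r + 1))" "q \<in> side M j s"
      "embed M i p = embed M j q" for j r s p q
    by (rule c3[rule_format, OF assms(2) that])
  show "r = s" if "edge M i r = edge M i s" for r s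
    by (rule injD[OF c4[rule_format, OF assms(2)] that])
  show "card {j\<in>cells M. \<exists>s. edge M j s = edge M i r} = 2" for r
    by (rule c5[rule_format, OF assms(2)])
  fix j r s assume h: "j \<in> cells M" "i \<noteq> j" "edge M i r = edge M j s"
  note c7 = c6[rule_format, OF assms(2) h(1) conjI, OF h(2,3)]
  show "corner M i (r + 1) - corner M i r = corner M j s - corner M j (s + 1)"
    by (rule c7[THEN conjunct1])
  show "embed M i p = embed M j (p + (corner M j (s + 1) - corner M i r))"
    if "p \<in> side M i r" for p
    by (rule c7[THEN conjunct2, rule_format, OF that])
qed

lemma corner_neq:
  assumes "closed_quad_mesh M" "i \<in> cells M"
  shows "corner M i r \<noteq> corner M i (r + 1)"
proof
  assume eq: "corner M i r = corner M i (r + 1)"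
  have "ccw_quadrilateral (corner M i)"
    using closed_quad_meshD(1)[OF assms] .
  then have "closed_segment (corner M i (r - 1)) (corner M i ((r - 1) + 1)) \<inter>
        closed_segment (corner M i ((r - 1) + 2)) (corner M i ((r - 1) + 3)) = {}"
    unfolding ccw_quadrilateral_def by blast
  moreover have "(r - 1) + 2 = r + 1"
    by simp
  ultimately show False
    using eq ends_in_segment(2)[of "corner M i r" "corner M i (r - 1)"]
      ends_in_segment(1)[of "corner M i (r + 1)" "corner M i (r - 1 + 3)"] by auto
qed

lemma half_edge_subset_side:
  "closed_segment (corner M i r) (edge_mid M i r) \<subseteq> side M i r"
  "closed_segment (edge_mid M i r) (corner M i (r + 1)) \<subseteq> side M i r"
  by (simp_all add: side_def edge_mid_def subset_closed_segment)

text \<open>Quarter points witness that the two halves of an edge, and half edges of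
  different edges, are different.\<close>

lemma quarter_points:
  fixes r :: 4
  assumes "closed_quad_mesh M" "i \<in> cells M"
  defines "a \<equiv> corner M i r" and "b \<equiv> corner M i (r + 1)"
  shows "midpoint a (edge_mid M i r) \<in> open_segment a b"
    and "midpoint a (edge_mid M i r) \<notin> closed_segment (edge_mid M i r) b"
    and "midpoint (edge_mid M i r) b \<in> open_segment a b"
proof -
  have ab: "a \<noteq> b"
    using corner_neq[OF assms(1,2)] by (simp add: a_def b_def)
  have 1: "midpoint a (edge_mid M i r) = (1 - 1/4) *\<^sub>R a + (1/4) *\<^sub>R b"
    unfolding edge_mid_def midpoint_def a_def[symmetric] b_def[symmetric]
    by (simp add: vec_eq_iff field_simps)
  have 2: "midpoint (edge_mid M i r) b = (1 - 3/4) *\<^sub>R a + (3/4) *\<^sub>R b"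
    unfolding edge_mid_def midpoint_def a_def[symmetric] b_def[symmetric]
    by (simp add: vec_eq_iff field_simps)
  show "midpoint a (edge_mid M i r) \<in> open_segment a b"
    unfolding in_segment(2) using ab 1 by (intro conjI exI[of _ "1/4"]) auto
  show "midpoint (edge_mid M i r) b \<in> open_segment a b"
    unfolding in_segment(2) using ab 2 by (intro conjI exI[of _ "3/4"]) auto
  show "midpoint a (edge_mid M i r) \<notin> closed_segment (edge_mid M i r) b"
  proof
    assume "midpoint a (edge_mid M i r) \<in> closed_segment (edge_mid M i r) b"
    then obtain u where u: "0 \<le> u" "u \<le> 1"
      "midpoint a (edge_mid M i r) = (1 - u) *\<^sub>R edge_mid M i r + u *\<^sub>R b"
      by (auto simp: in_segment)
    have "(1/4 + u/2) *\<^sub>R (b - a) =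
        ((1 - u) *\<^sub>R edge_mid M i r + u *\<^sub>R b) - midpoint a (edge_mid M i r)"
      unfolding 1 unfolding edge_mid_def midpoint_def a_def[symmetric] b_def[symmetric]
      by (simp add: vec_eq_iff field_simps)
    then have "(1/4 + u/2) *\<^sub>R (b - a) = 0"
      using u(3) by simp
    then show False
      using ab u(1) by simp
  qed
qed

lemma half_fst_neq_half_snd:
  assumes "closed_quad_mesh M" "i \<in> cells M"
  shows "half_fst M i r \<noteq> half_snd M i r"
proof
  assume eq: "half_fst M i r = half_snd M i r"
  let ?p = "midpoint (corner M i r) (edge_mid M i r)"
  have "embed M i ?p \<in> half_snd M i r"
    unfolding eq[symmetric] by (simp add: half_fst_def)
  then obtain q where q: "q \<in> closed_segment (edge_mid M i r) (corner M i (r + 1))"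
      "embed M i ?p = embed M i q"
    by (auto simp: half_snd_def)
  moreover have "q \<in> side M i r"
    using q half_edge_subset_side(2) by blast
  ultimately have "?p = q"
    using closed_quad_meshD(2)[OF assms quarter_points(1)[OF assms]] by blast
  then show False
    using q quarter_points(2)[OF assms, of r] by simp
qed

lemma half_edge_determines_edge:
  assumes "closed_quad_mesh M" "i \<in> cells M" "j \<in> cells M"
    and "H \<in> {half_fst M i r, half_snd M i r}" "H \<in> {half_fst M j s, half_snd M j s}"
  shows "edge M i r = edge M j s"
proof -
  obtain p where p: "p \<in> open_segment (corner M i r) (corner M i (r + 1))" "embed M i p \<in> H"
    using assms(4) quarter_points(1,3)[OF assms(1,2), of r]
    by (auto simp: half_fst_def half_snd_def)
  have "H \<subseteq> edge M j s"
    using assms(5) half_edge_subset_side[of M j s]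
    by (auto simp: half_fst_def half_snd_def edge_def)
  then obtain q where "q \<in> side M j s" "embed M i p = embed M j q"
    using p(2) by (auto simp: edge_def)
  then show ?thesis
    using closed_quad_meshD(3)[OF assms(1-3) p(1)] by blast
qed

lemma shared_edge:
  assumes "closed_quad_mesh M" "i \<in> cells M" "j \<in> cells M" "i \<noteq> j" "edge M i r = edge M j s"
  shows "half_fst M i r = half_snd M j s" and "half_snd M i r = half_fst M j s"
    and "node M i r = node M j (s + 1)" and "node M i (r + 1) = node M j s"
    and "edge_length M i r = edge_length M j s" and "normal_vec M i r = - normal_vec M j s"
proof -
  define c where "c = corner M j (s + 1) - corner M i r"
  have d: "corner M i (r + 1) - corner M i r = corner M j s - corner M j (s + 1)"
    and g: "\<And>p. p \<in> side M i r \<Longrightarrow> embed M i p = embed M j (p + c)"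
    using closed_quad_meshD(6,7)[OF assms] by (simp_all add: c_def)
  have c1: "corner M i r + c = corner M j (s + 1)"
    by (simp add: c_def)
  have c2: "corner M i (r + 1) + c = corner M j s"
    using d by (simp add: c_def algebra_simps)
  have c3: "edge_mid M i r + c = edge_mid M j s"
    unfolding edge_mid_def c1[symmetric] c2[symmetric]
    by (simp add: midpoint_def vec_eq_iff field_simps)
  have tr: "embed M i ` closed_segment a b = embed M j ` closed_segment (a + c) (b + c)"
    if "closed_segment a b \<subseteq> side M i r" for a b
  proof -
    have "closed_segment (a + c) (b + c) = (\<lambda>p. p + c) ` closed_segment a b"
      using closed_segment_translation[of c a b] by (simp add: add.commute)
    then show ?thesis
      using g that by (auto simp: image_image intro!: image_cong)
  qed
  show "half_fst M i r = half_snd M j s" "half_snd M i r = half_fst M j s"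
    unfolding half_fst_def half_snd_def
    using tr[OF half_edge_subset_side(1)] tr[OF half_edge_subset_side(2)]
    by (simp_all add: c1 c2 c3 closed_segment_commute)
  show "node M i r = node M j (s + 1)" "node M i (r + 1) = node M j s"
    unfolding node_def by (subst g; simp add: side_def c1 c2)+
  show l: "edge_length M i r = edge_length M j s"
    unfolding edge_length_def dist_norm using d by (metis norm_minus_commute)
  show "normal_vec M i r = - normal_vec M j s"
    unfolding normal_vec_def Let_def l d
    by (simp add: vec_eq_iff forall_2 diff_divide_distrib)
qed

lemma neighbour_ex:
  assumes "closed_quad_mesh M" "i \<in> cells M"
  obtains j s where "j \<in> cells M" "j \<noteq> i" "edge M i r = edge M j s"
proof -
  have "card {j\<in>cells M. \<exists>s. edge M j s = edge M i r} = 2"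
    using closed_quad_meshD(5)[OF assms] .
  then obtain a b where "{j\<in>cells M. \<exists>s. edge M j s = edge M i r} = {a, b}" "a \<noteq> b"
    by (auto simp: card_2_iff)
  then have "a \<in> {j\<in>cells M. \<exists>s. edge M j s = edge M i r}"
      "b \<in> {j\<in>cells M. \<exists>s. edge M j s = edge M i r}"  "a \<noteq> i \<or> b \<noteq> i"
    by auto
  then show ?thesis
    using that by (elim CollectE conjE exE disjE) (metis+)
qed

lemma half_fst_inj:
  assumes "closed_quad_mesh M" "i \<in> cells M" "j \<in> cells M" "half_fst M i r = half_fst M j s"
  shows "i = j \<and> r = s"
proof -
  have e: "edge M i r = edge M j s"
    using half_edge_determines_edge[OF assms(1-3), of "half_fst M i r"] assms(4) by simp
  have "i = j"
    using shared_edge(1)[OF assms(1-3) _ e] half_fst_neq_half_snd[OF assms(1,3), of s] assms(4) by auto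
  moreover from this have "r = s"
    using e closed_quad_meshD(4)[OF assms(1,2)] by blast
  ultimately show ?thesis by simp
qed

lemma half_snd_inj:
  assumes "closed_quad_mesh M" "i \<in> cells M" "j \<in> cells M" "half_snd M i r = half_snd M j s"
  shows "i = j \<and> r = s"
proof -
  have e: "edge M i r = edge M j s"
    using half_edge_determines_edge[OF assms(1-3), of "half_snd M i r"] assms(4) by simp
  have "i = j"
    using shared_edge(2)[OF assms(1-3) _ e] half_fst_neq_half_snd[OF assms(1,3), of s] assms(4) by auto
  moreover from this have "r = s"
    using e closed_quad_meshD(4)[OF assms(1,2)] by blast
  ultimately show ?thesis by simp
qed

lemma half_edge_repr_ex1:
  assumes "closed_quad_mesh M" "e \<in> half_edges M x"
  shows "\<exists>!(i, r, j, k). half_edge_repr M x e i r j k"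
proof -
  have "\<exists>i r j k. half_edge_repr M x e i r j k"
    using assms(2) unfolding half_edges_def
  proof (elim UnE CollectE exE conjE)
    fix i r assume h: "e = half_fst M i r" "i \<in> cells M" "node M i r = x"
    obtain j s where "j \<in> cells M" "j \<noteq> i" "edge M i r = edge M j s"
      using neighbour_ex[OF assms(1) h(2)] .
    then have "half_edge_repr M x e i r j (s + 1)"
      using shared_edge[OF assms(1) h(2), of j r s] h by (simp add: half_edge_repr_def)
    then show ?thesis by blast
  next
    fix i r assume h: "e = half_snd M i r" "i \<in> cells M" "node M i (r + 1) = x"
    obtain j s where "j \<in> cells M" "j \<noteq> i" "edge M i r = edge M j s"
      using neighbour_ex[OF assms(1) h(2)] .
    then have "half_edge_repr M x e j s i (r + 1)"
      using shared_edge[OF assms(1) h(2), of j r s] h by (simp add: half_edge_repr_def)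
    then show ?thesis by blast
  qed
  moreover have "i = i' \<and> r = r' \<and> j = j' \<and> k = k'"
    if "half_edge_repr M x e i r j k" "half_edge_repr M x e i' r' j' k'" for i r j k i' r' j' k'
  proof -
    have "i = i' \<and> r = r'"
      using that by (intro half_fst_inj[OF assms(1)]) (auto simp: half_edge_repr_def)
    moreover have "j = j' \<and> k - 1 = k' - 1"
      using that by (intro half_snd_inj[OF assms(1)]) (auto simp: half_edge_repr_def)
    ultimately show ?thesis
      by simp
  qed
  ultimately show ?thesis
    unfolding Ex1_def split_paired_Ex split_paired_All by simp blast
qed

lemma half_edge_sides_eq:
  assumes "closed_quad_mesh M" "e \<in> half_edges M x" "half_edge_repr M x e i r j k"
  shows "half_edge_sides M x e = (i, r, j, k)"
  unfolding half_edge_sides_def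
  by (rule the1_equality[OF half_edge_repr_ex1[OF assms(1,2)]]) (use assms(3) in simp)

lemma half_edge_normal_eq:
  assumes "closed_quad_mesh M" "half_edge_repr M x e i r j k"
  shows "normal_vec M i r = - normal_vec M j (k - 1)"
proof -
  have h: "i \<in> cells M" "j \<in> cells M" "half_fst M i r = half_snd M j (k - 1)"
    using assms(2) by (auto simp: half_edge_repr_def)
  have e: "edge M i r = edge M j (k - 1)"
    using half_edge_determines_edge[OF assms(1) h(1,2), of "half_fst M i r"] h(3) by simp
  have "i \<noteq> j"
    using e h(3) half_fst_neq_half_snd[OF assms(1) h(1), of r]
      closed_quad_meshD(4)[OF assms(1) h(1), of r "k - 1"] by auto
  then show ?thesis
    using shared_edge(6)[OF assms(1) h(1,2) _ e] by blast
qed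

end

theory Submission
  imports Defs
begin

text \<open>
  Every half edge at a vertex is the first half of an edge of exactly one cell and the second half
  of an edge of exactly one other cell. Hence the sum of the \<open>+\<close> parts of the node forces over all
  vertices and half edges runs once through the first halves of all cell edges, and the sum of the
  \<open>-\<close> parts runs once through the second halves; the sign is absorbed by the opposite normals.

  As a half edge has half the length of its edge, this turns the cell fluxes into \<^emph>\<open>twice\<close> the node
  forces. The stated middle equalities, which do not show this factor, hold because the balance
  condition makes both of their sides vanish.
\<close>

lemma finite_cells [simp]: "finite (cells M)"
  by (simp add: cells_def)

lemma vertices_eq_image: "vertices M = (\<lambda>(i, r). node M i r) ` (cells M \<times> UNIV)"
  unfolding vertices_def by auto

lemma node_in_vertices: "i \<in> cells M \<Longrightarrow> node M i r \<in> vertices M"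
  unfolding vertices_def by blast

lemma finite_vertices [simp]: "finite (vertices M)"
  by (simp add: vertices_eq_image)

lemma half_edges_repr_ex:
  assumes "closed_quad_mesh M" "e \<in> half_edges M x"
  obtains i r j k where "half_edge_repr M x e i r j k"
  using half_edge_repr_ex1[OF assms] by auto

text \<open>A second half ending at \<open>x\<close> is also a first half starting at
  \<open>x\<close>, seen from the neighbouring cell, so first halves alone index the half edges. The
  index set is a fibre of the node map, the shape that \<open>sum.group\<close> expects.\<close>

lemma half_edges_eq_half_fst:
  assumes "closed_quad_mesh M"
  shows "half_edges M x =
    (\<lambda>(i, r). half_fst M i r) ` {p \<in> cells M \<times> UNIV. (\<lambda>(i, r). node M i r) p = x}" (is "_ = ?R")
proof
  show "half_edges M x \<subseteq> ?R"
  proof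
    fix e assume "e \<in> half_edges M x"
    then obtain i r j k where "half_edge_repr M x e i r j k"
      using half_edges_repr_ex[OF assms] by blast
    then show "e \<in> ?R"
      by (intro image_eqI[of _ _ "(i, r)"]) (auto simp: half_edge_repr_def)
  qed
  show "?R \<subseteq> half_edges M x"
    unfolding half_edges_def by auto
qed

lemma half_edges_eq_half_snd:
  assumes "closed_quad_mesh M"
  shows "half_edges M x =
    (\<lambda>(j, s). half_snd M j s) ` {p \<in> cells M \<times> UNIV. (\<lambda>(j, s). node M j (s + 1)) p = x}"
    (is "_ = ?R")
proof
  show "half_edges M x \<subseteq> ?R"
  proof
    fix e assume "e \<in> half_edges M x"
    then obtain i r j k where "half_edge_repr M x e i r j k"
      using half_edges_repr_ex[OF assms] by blast
    \<comment> \<open>\<open>k\<close> numbers the corner where the half edge ends, so the edge of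
      cell \<open>j\<close> containing it is \<open>k - 1\<close>.\<close>
    then show "e \<in> ?R"
      by (intro image_eqI[of _ _ "(j, k - 1)"]) (auto simp: half_edge_repr_def)
  qed
  show "?R \<subseteq> half_edges M x"
    unfolding half_edges_def by auto
qed

text \<open>The fibres of the node map partition all pairs of cell and corner, and injectivity of
  \<open>half_fst\<close> excludes double counting.\<close>

lemma sum_half_edges_half_fst:
  fixes F :: "'p \<Rightarrow> 'p set \<Rightarrow> 'b::comm_monoid_add"
  assumes "closed_quad_mesh M"
  shows "(\<Sum>x\<in>vertices M. \<Sum>e\<in>half_edges M x. F x e) =
    (\<Sum>i\<in>cells M. \<Sum>r\<in>UNIV. F (node M i r) (half_fst M i r))"
proof -
  let ?S = "cells M \<times> (UNIV :: 4 set)" and ?n = "\<lambda>(i, r). node M i r"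
  have inj: "inj_on (\<lambda>(i, r). half_fst M i r) ?S"
    by (auto intro!: inj_onI dest: half_fst_inj[OF assms])
  \<comment> \<open>On the fibre over \<open>x\<close>, \<open>x\<close> is the node of the index
    \<open>p\<close>. Written this way the summand depends on \<open>p\<close> only, so the fibres
    can be merged.\<close>
  have "(\<Sum>e\<in>half_edges M x. F x e) =
      (\<Sum>p\<in>{p \<in> ?S. ?n p = x}. F (?n p) (case p of (i, r) \<Rightarrow> half_fst M i r))" for x
    unfolding half_edges_eq_half_fst[OF assms]
    by (subst sum.reindex[OF inj_on_subset[OF inj]]) auto
  then have "(\<Sum>x\<in>vertices M. \<Sum>e\<in>half_edges M x. F x e) =
      (\<Sum>p\<in>?S. F (?n p) (case p of (i, r) \<Rightarrow> half_fst M i r))"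
    by (simp only:, intro sum.group) (auto simp: node_in_vertices)
  then show ?thesis
    by (simp add: sum.cartesian_product case_prod_unfold)
qed

text \<open>The same count from the other cell at each half edge: second halves are grouped by their
  end corner \<open>s + 1\<close>.\<close>

lemma sum_half_edges_half_snd:
  fixes F :: "'p \<Rightarrow> 'p set \<Rightarrow> 'b::comm_monoid_add"
  assumes "closed_quad_mesh M"
  shows "(\<Sum>x\<in>vertices M. \<Sum>e\<in>half_edges M x. F x e) =
    (\<Sum>j\<in>cells M. \<Sum>s\<in>UNIV. F (node M j (s + 1)) (half_snd M j s))"
proof -
  let ?S = "cells M \<times> (UNIV :: 4 set)" and ?n = "\<lambda>(j, s). node M j (s + 1)"
  have inj: "inj_on (\<lambda>(j, s). half_snd M j s) ?S"
    by (auto intro!: inj_onI dest: half_snd_inj[OF assms])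
  have "(\<Sum>e\<in>half_edges M x. F x e) =
      (\<Sum>p\<in>{p \<in> ?S. ?n p = x}. F (?n p) (case p of (j, s) \<Rightarrow> half_snd M j s))" for x
    unfolding half_edges_eq_half_snd[OF assms]
    by (subst sum.reindex[OF inj_on_subset[OF inj]]) auto
  then have "(\<Sum>x\<in>vertices M. \<Sum>e\<in>half_edges M x. F x e) =
      (\<Sum>p\<in>?S. F (?n p) (case p of (j, s) \<Rightarrow> half_snd M j s))"
    by (simp only:, intro sum.group) (auto simp: node_in_vertices)
  then show ?thesis
    by (simp add: sum.cartesian_product case_prod_unfold)
qed

lemma dist_corner_edge_mid: "dist (corner M i r) (edge_mid M i r) = edge_length M i r / 2"
  by (simp add: edge_mid_def edge_length_def dist_midpoint)

text \<open>Any neighbour across the edge completes a representation, and uniqueness makes it the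
  value of the definite description \<open>half_edge_sides\<close>.\<close>

lemma half_fst_geometry:
  assumes "closed_quad_mesh M" "i \<in> cells M"
  shows "half_edge_length M (node M i r) (half_fst M i r) = edge_length M i r / 2"
    and "half_edge_normal M (node M i r) (half_fst M i r) = normal_vec M i r"
    and "pressure_plus M hp (node M i r) (half_fst M i r) = hp_fst hp i r"
proof -
  obtain j s where "j \<in> cells M" "j \<noteq> i" "edge M i r = edge M j s"
    using neighbour_ex[OF assms] .
  \<comment> \<open>The neighbour runs through the edge backwards, so corner \<open>r\<close> of
    \<open>i\<close> meets the end corner \<open>s + 1\<close> of edge \<open>s\<close> of
    \<open>j\<close>.\<close>
  then have "half_edge_repr M (node M i r) (half_fst M i r) i r j (s + 1)"
    using shared_edge[OF assms, of j r s] assms by (simp add: half_edge_repr_def)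
  moreover have "half_fst M i r \<in> half_edges M (node M i r)"
    using assms(2) unfolding half_edges_def by blast
  ultimately have "half_edge_sides M (node M i r) (half_fst M i r) = (i, r, j, s + 1)"
    by (intro half_edge_sides_eq[OF assms(1)])
  then show "half_edge_length M (node M i r) (half_fst M i r) = edge_length M i r / 2"
    and "half_edge_normal M (node M i r) (half_fst M i r) = normal_vec M i r"
    and "pressure_plus M hp (node M i r) (half_fst M i r) = hp_fst hp i r"
    by (simp_all add: half_edge_length_def half_edge_normal_def pressure_plus_def
        dist_corner_edge_mid)
qed

text \<open>Length and normal of a half edge are read off in the cell that sees it as a first half,
  here the neighbour \<open>i\<close>. Carrying them over to \<open>j\<close> keeps the length and
  flips the normal.\<close>

lemma half_snd_geometry:
  assumes "closed_quad_mesh M" "j \<in> cells M"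
  shows "half_edge_length M (node M j (s + 1)) (half_snd M j s) = edge_length M j s / 2"
    and "half_edge_normal M (node M j (s + 1)) (half_snd M j s) = - normal_vec M j s"
    and "pressure_minus M hp (node M j (s + 1)) (half_snd M j s) = hp_snd hp j s"
proof -
  obtain i r where ir: "i \<in> cells M" "i \<noteq> j" "edge M j s = edge M i r"
    using neighbour_ex[OF assms] .
  note shared = shared_edge[OF assms ir(1) ir(2)[symmetric] ir(3)]
  have "half_edge_repr M (node M j (s + 1)) (half_snd M j s) i r j (s + 1)"
    using shared assms ir by (simp add: half_edge_repr_def)
  moreover have "half_snd M j s \<in> half_edges M (node M j (s + 1))"
    using assms(2) unfolding half_edges_def by blast
  ultimately have "half_edge_sides M (node M j (s + 1)) (half_snd M j s) = (i, r, j, s + 1)"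
    by (intro half_edge_sides_eq[OF assms(1)])
  then show "half_edge_length M (node M j (s + 1)) (half_snd M j s) = edge_length M j s / 2"
    and "half_edge_normal M (node M j (s + 1)) (half_snd M j s) = - normal_vec M j s"
    and "pressure_minus M hp (node M j (s + 1)) (half_snd M j s) = hp_snd hp j s"
    using shared
    by (simp_all add: half_edge_length_def half_edge_normal_def pressure_minus_def
        dist_corner_edge_mid)
qed

text \<open>Momentum and energy need the same regrouping; \<open>g x\<close> is the identity for the
  one and the inner product with \<open>vt x\<close> for the other. Linearity moves
  \<open>g x\<close> inside the sum over half edges.\<close>

lemma sum_node_force_linear:
  fixes g :: "'p \<Rightarrow> real^2 \<Rightarrow> 'b::real_vector"
  assumes M: "closed_quad_mesh M" and g: "\<And>x. linear (g x)"
  shows "2 *\<^sub>R (\<Sum>x\<in>vertices M. g x (node_force M hp x)) =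
    (\<Sum>i\<in>cells M. \<Sum>r\<in>UNIV. edge_length M i r *\<^sub>R
      (hp_fst hp i r *\<^sub>R g (node M i r) (normal_vec M i r)
       + hp_snd hp i r *\<^sub>R g (node M i (r + 1)) (normal_vec M i r)))"
proof -
  \<comment> \<open>The factor 2 turns the length of a half edge into that of its edge.\<close>
  let ?P = "\<lambda>x e. (2 * half_edge_length M x e * pressure_plus M hp x e) *\<^sub>R
    g x (half_edge_normal M x e)"
  let ?N = "\<lambda>x e. (2 * half_edge_length M x e * pressure_minus M hp x e) *\<^sub>R
    g x (half_edge_normal M x e)"
  have "2 *\<^sub>R (\<Sum>x\<in>vertices M. g x (node_force M hp x)) =
      (\<Sum>x\<in>vertices M. \<Sum>e\<in>half_edges M x. ?P x e - ?N x e)"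
    unfolding node_force_def
    by (simp add: linear_sum[OF g] linear_diff[OF g] linear_cmul[OF g] scaleR_sum_right
        algebra_simps)
  also have "\<dots> = (\<Sum>x\<in>vertices M. \<Sum>e\<in>half_edges M x. ?P x e)
      - (\<Sum>x\<in>vertices M. \<Sum>e\<in>half_edges M x. ?N x e)"
    by (simp add: sum_subtractf)
  also have "(\<Sum>x\<in>vertices M. \<Sum>e\<in>half_edges M x. ?P x e) =
      (\<Sum>i\<in>cells M. \<Sum>r\<in>UNIV. (edge_length M i r * hp_fst hp i r) *\<^sub>R
        g (node M i r) (normal_vec M i r))"
    unfolding sum_half_edges_half_fst[OF M] by (simp add: half_fst_geometry[OF M])
  \<comment> \<open>The half-edge normal points into cell \<open>j\<close>; passing to the outward
    normal of \<open>j\<close> gives the sign that turns the pressure difference into a sum.\<close>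
  also have "(\<Sum>x\<in>vertices M. \<Sum>e\<in>half_edges M x. ?N x e) =
      - (\<Sum>i\<in>cells M. \<Sum>r\<in>UNIV. (edge_length M i r * hp_snd hp i r) *\<^sub>R
        g (node M i (r + 1)) (normal_vec M i r))"
    unfolding sum_half_edges_half_snd[OF M]
    by (simp add: half_snd_geometry[OF M] linear_neg[OF g] sum_negf)
  finally show ?thesis
    by (simp add: sum.distrib scaleR_add_right)
qed

lemma sum_momentum_flux:
  assumes "closed_quad_mesh M"
  shows "(\<Sum>i\<in>cells M. momentum_flux M hp i) = 2 *\<^sub>R (\<Sum>x\<in>vertices M. node_force M hp x)"
  using sum_node_force_linear[OF assms, of "\<lambda>x v. v" hp]
  by (simp add: momentum_flux_def linear_id[unfolded id_def] algebra_simps)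

text \<open>All cells meeting at a vertex use the same velocity \<open>vt x\<close>, so it factors
  out of the sum over the half edges there.\<close>

lemma sum_energy_flux:
  assumes "closed_quad_mesh M"
  shows "(\<Sum>i\<in>cells M. energy_flux M vt hp i) = 2 * (\<Sum>x\<in>vertices M. vt x \<bullet> node_force M hp x)"
  using sum_node_force_linear[OF assms, of "\<lambda>x v. vt x \<bullet> v" hp]
  by (simp add: energy_flux_def inner_add_left bounded_linear_inner_right
      bounded_linear.linear)

theorem theorem1:
  fixes M :: "'p mesh" and D :: input_data
    and vt :: "'p \<Rightarrow> real^2" and hp :: half_pressures
    and m :: "nat \<Rightarrow> real" and vbar :: "nat \<Rightarrow> real \<Rightarrow> real^2" and Ebar :: "nat \<Rightarrow> real \<Rightarrow> real"
    and t :: real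
  assumes mesh: "closed_quad_mesh M"
    and imp_pos: "\<And>i r. i \<in> cells M \<Longrightarrow> 0 < imp D i r \<and> 0 < imp_mid D i r"
    and mass_pos: "\<And>i. i \<in> cells M \<Longrightarrow> 0 < m i"
    and jump: "jump_condition M D vt hp"
    and balance: "balance_condition M hp"
    and momentum_eq: "\<And>i. i \<in> cells M \<Longrightarrow>
      vbar i differentiable at t \<and>
      m i *\<^sub>R vector_derivative (vbar i) (at t) = - (1/2) *\<^sub>R momentum_flux M hp i"
    and energy_eq: "\<And>i. i \<in> cells M \<Longrightarrow>
      Ebar i differentiable at t \<and>
      m i * deriv (Ebar i) t = - (1/2) * energy_flux M vt hp i"
  shows
    "((\<lambda>\<tau>. \<Sum>i\<in>cells M. m i *\<^sub>R vbar i \<tau>) has_vector_derivative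
        - (1/2) *\<^sub>R (\<Sum>i\<in>cells M. momentum_flux M hp i)) (at t)
     \<and> - (1/2) *\<^sub>R (\<Sum>i\<in>cells M. momentum_flux M hp i)
         = - (1/2) *\<^sub>R (\<Sum>x\<in>vertices M. node_force M hp x)
     \<and> - (1/2) *\<^sub>R (\<Sum>x\<in>vertices M. node_force M hp x) = 0
     \<and> ((\<lambda>\<tau>. \<Sum>i\<in>cells M. m i * Ebar i \<tau>) has_real_derivative
        - (1/2) * (\<Sum>i\<in>cells M. energy_flux M vt hp i)) (at t)
     \<and> - (1/2) * (\<Sum>i\<in>cells M. energy_flux M vt hp i)
         = - (1/2) * (\<Sum>x\<in>vertices M. vt x \<bullet> node_force M hp x)
     \<and> - (1/2) * (\<Sum>x\<in>vertices M. vt x \<bullet> node_force M hp x) = 0"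
proof -
  have node_force_0: "node_force M hp x = 0" if "x \<in> vertices M" for x
    using balance that by (simp add: balance_condition_def)
  \<comment> \<open>Conservation enters here: after regrouping, every term contains a node force,
    which the balance condition makes zero.\<close>
  have "(\<Sum>i\<in>cells M. momentum_flux M hp i) = 0" "(\<Sum>i\<in>cells M. energy_flux M vt hp i) = 0"
    by (simp_all add: sum_momentum_flux[OF mesh] sum_energy_flux[OF mesh] node_force_0)
  moreover have "((\<lambda>\<tau>. m i *\<^sub>R vbar i \<tau>) has_vector_derivative - (1/2) *\<^sub>R momentum_flux M hp i)
      (at t)" if "i \<in> cells M" for i
  proof -
    have "(vbar i has_vector_derivative vector_derivative (vbar i) (at t)) (at t)"
      using momentum_eq[OF that] vector_derivative_works by blast
    \<comment> \<open>The mass is constant in time, so scaling by it is a fixed bounded linear map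
      and commutes with the derivative.\<close>
    then have "((\<lambda>\<tau>. m i *\<^sub>R vbar i \<tau>) has_vector_derivative
        m i *\<^sub>R vector_derivative (vbar i) (at t)) (at t)"
      by (rule bounded_linear.has_vector_derivative[OF bounded_linear_scaleR_right])
    then show ?thesis
      using momentum_eq[OF that] by simp
  qed
  then have "((\<lambda>\<tau>. \<Sum>i\<in>cells M. m i *\<^sub>R vbar i \<tau>) has_vector_derivative
      - (1/2) *\<^sub>R (\<Sum>i\<in>cells M. momentum_flux M hp i)) (at t)"
    unfolding scaleR_sum_right by (rule has_vector_derivative_sum)
  moreover have "((\<lambda>\<tau>. m i * Ebar i \<tau>) has_real_derivative - (1/2) * energy_flux M vt hp i)
      (at t)" if "i \<in> cells M" for i
  proof -
    have "(Ebar i has_real_derivative deriv (Ebar i) t) (at t)"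
      using energy_eq[OF that] DERIV_deriv_iff_real_differentiable by blast
    then show ?thesis
      using DERIV_cmult energy_eq[OF that] by metis
  qed
  then have "((\<lambda>\<tau>. \<Sum>i\<in>cells M. m i * Ebar i \<tau>) has_real_derivative
      - (1/2) * (\<Sum>i\<in>cells M. energy_flux M vt hp i)) (at t)"
    unfolding sum_distrib_left by (rule DERIV_sum)
  ultimately show ?thesis
    by (simp add: node_force_0)
qed

end
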